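(* Let $(\mathcal{H}, * )$ be a semigroup and let $E = E(\mathcal{H})$ be the set of all idempotent elements of $(\mathcal{H}, * )$. Then the following conditions (i) and (ii) are equivalent. (i) There is a nonempty set $X$ and a partition $P$ of $X$ such that $|P| \geq 2$ and the semigroup $(\mathcal{H}, * )$ is isomorphic to $(\mathcal{S}_{P \otimes P_S}, \circ)$. (ii) The semigroup $(\mathcal{H}, * )$ is a band of semigroups $\mathcal{H}_\alpha$, $\alpha \in \Omega$, with a core $\mathcal{C}$, and the following conditions hold: (ii$_1$) $\mathcal{C}$ belongs to $\mathbf{H}_1$. (ii$_2$) Every $\mathcal{H}_\alpha$ is a group of order $2$. (ii$_3$) $E$ is a commutative band. (ii$_4$) If $e_1, e_2$ are two distinct nontrivial idempotent elements of $\mathcal{C}$, then there is a unique $e \in E \setminus \mathcal{C}$ such that $$e_1 = e_1 * e \quad\text{and}\quad e_2 = e_2 * e. \qquad (\star)$$ Conversely, if $e \in E \setminus \mathcal{C}$, then there are exactly two distinct nontrivial $e_1, e_2 \in \mathcal{C} \cap E$ such that $(\star)$ holds. (ii$_5$) For every $x \in E \cap \mathcal{C}$ and every $y \in \mathcal{H} \setminus E$, the equality $x * y = \theta$ holds if and only if $x * y$ is idempotent, and the equality $y * x = \theta$ holds if and only if $y * x$ is idempotent.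
   Context: A semigroup is a nonempty set with an associative operation. A zero of a semigroup is an element $\theta$ with $\theta * s = s * \theta = \theta$ for all $s$; by convention a semigroup must have at least two elements to possess a zero, and the unique element of a one-element semigroup is regarded as its identity element. In the claim $\theta$ denotes the zero element of $\mathcal{H}$ (the zero of an ideal of $\mathcal{H}$ is also the zero of $\mathcal{H}$). An element $i$ is idempotent if $i*i=i$. The identity element (if it exists) and the zero (if it exists) of a semigroup are its trivial idempotent elements; its other idempotents are nontrivial. A band is a semigroup all of whose elements are idempotent; "$E$ is a commutative band" means that $E$ is closed under $*$ and $*$ is commutative on $E$. An ideal of $(\mathcal{H},* )$ is a subsemigroup $\mathcal{C}$ (nonempty) such that $c*h \in \mathcal{C}$ and $h*c \in \mathcal{C}$ for all $c\in \mathcal{C}$, $h \in \mathcal{H}$. Let $\mathcal{C}$ be an ideal of $\mathcal{H}$. $\mathcal{H}$ is a band of (sub)semigroups with core $\mathcal{C}$ if there is a partition $\{\mathcal{H}_\alpha : \alpha \in \Omega\}$ of the set $\mathcal{H} \setminus \mathcal{C}$ such that every $\mathcal{H}_\alpha$ is a subsemigroup of $\mathcal{H}$ and $\mathcal{H}_{\alpha_1} * \mathcal{H}_{\alpha_2} \subseteq \mathcal{C}$ for all distinct $\alpha_1, \alpha_2 \in \Omega$. A partition of a nonempty set is a set of nonempty pairwise disjoint subsets with union the whole set; there is no partition of $\varnothing$, so $\mathcal{H}\setminus\mathcal{C}$ and $\Omega$ are nonempty. $\mathbf{H}_1$ is the class of all semigroups $(\mathcal{K}, * )$ such that: (1) $\mathcal{K}$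 contains a zero $\theta$ if $|\mathcal{K}| \geq 2$; (2) $x * y = \theta$ for all distinct idempotents $x, y \in \mathcal{K}$; (3) if $i_l, i_r$ are nontrivial idempotents of $\mathcal{K}$, then there is a unique nonzero $a \in \mathcal{K}$ with $a = i_l * a * i_r$; (4) if $|\mathcal{K}| \geq 2$, then for every nonzero $a \in \mathcal{K}$ there is a unique pair $(i_{la}, i_{ra})$ of nontrivial idempotents of $\mathcal{K}$ with $a = i_{la} * a * i_{ra}$. For a partition $P = \{X_j : j \in J\}$ of $X$, $P \otimes P_S$ is the partition of $X^2 = X\times X$ whose blocks are exactly the sets $(X_{j_1} \times X_{j_2}) \cup (X_{j_2} \times X_{j_1})$, $j_1, j_2 \in J$ (not necessarily distinct). Binary relations on $X$ (subsets of $X^2$) are composed by: $\langle x,y\rangle \in \psi \circ \gamma$ iff there is $z \in X$ with $\langle x,z\rangle \in \psi$ and $\langle z,y\rangle \in \gamma$. For a nonempty set $Q$ of binary relations on $X$, $\mathcal{S}_Q$ is the semigroup, under $\circ$, generated by $Q$. *)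

theory Defs
  imports "HOL-Algebra.Coset" "HOL-Library.Disjoint_Sets"
begin

text \<open>
  A semigroup is given by a carrier set and an operation. The operation is a total function on the
  ambient type; only its values on the carrier are used.
\<close>

definition semigroup_on :: "'a set \<Rightarrow> ('a \<Rightarrow> 'a \<Rightarrow> 'a) \<Rightarrow> bool" where
  "semigroup_on H m \<longleftrightarrow>
     H \<noteq> {} \<and>
     (\<forall>x\<in>H. \<forall>y\<in>H. m x y \<in> H) \<and>
     (\<forall>x\<in>H. \<forall>y\<in>H. \<forall>z\<in>H. m (m x y) z = m x (m y z))"

definition subsemigroup :: "'a set \<Rightarrow> ('a \<Rightarrow> 'a \<Rightarrow> 'a) \<Rightarrow> 'a set \<Rightarrow> bool" where
  "subsemigroup H m A \<longleftrightarrow> A \<noteq> {} \<and> A \<subseteq> H \<and> (\<forall>x\<in>A. \<forall>y\<in>A. m x y \<in> A)"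

definition semigroup_iso ::
  "'a set \<Rightarrow> ('a \<Rightarrow> 'a \<Rightarrow> 'a) \<Rightarrow> 'b set \<Rightarrow> ('b \<Rightarrow> 'b \<Rightarrow> 'b) \<Rightarrow> bool" where
  "semigroup_iso H m K n \<longleftrightarrow>
     (\<exists>f. bij_betw f H K \<and> (\<forall>x\<in>H. \<forall>y\<in>H. f (m x y) = n (f x) (f y)))"

definition at_least_two :: "'a set \<Rightarrow> bool" where
  "at_least_two A \<longleftrightarrow> (\<exists>x\<in>A. \<exists>y\<in>A. x \<noteq> y)"

text \<open>
  By convention a one-element semigroup has an identity but no zero, so the predicate
  \<open>is_zero\<close> is false there. When there is a zero, it is unique, so that
  \<open>is_zero H m x\<close> renders \<open>x = \<theta>\<close>.
\<close>

definition is_zero :: "'a set \<Rightarrow> ('a \<Rightarrow> 'a \<Rightarrow> 'a) \<Rightarrow> 'a \<Rightarrow> bool" where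
  "is_zero H m z \<longleftrightarrow> at_least_two H \<and> z \<in> H \<and> (\<forall>s\<in>H. m z s = z \<and> m s z = z)"

definition is_identity :: "'a set \<Rightarrow> ('a \<Rightarrow> 'a \<Rightarrow> 'a) \<Rightarrow> 'a \<Rightarrow> bool" where
  "is_identity H m e \<longleftrightarrow> e \<in> H \<and> (\<forall>s\<in>H. m e s = s \<and> m s e = s)"

definition idempotents :: "'a set \<Rightarrow> ('a \<Rightarrow> 'a \<Rightarrow> 'a) \<Rightarrow> 'a set" where
  "idempotents H m = {i \<in> H. m i i = i}"

definition nontrivial_idempotents :: "'a set \<Rightarrow> ('a \<Rightarrow> 'a \<Rightarrow> 'a) \<Rightarrow> 'a set" where
  "nontrivial_idempotents H m =
     {i \<in> idempotents H m. \<not> is_zero H m i \<and> \<not> is_identity H m i}"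

definition semigroup_ideal :: "'a set \<Rightarrow> ('a \<Rightarrow> 'a \<Rightarrow> 'a) \<Rightarrow> 'a set \<Rightarrow> bool" where
  "semigroup_ideal H m C \<longleftrightarrow>
     subsemigroup H m C \<and> (\<forall>c\<in>C. \<forall>h\<in>H. m c h \<in> C \<and> m h c \<in> C)"

definition commutative_band :: "('a \<Rightarrow> 'a \<Rightarrow> 'a) \<Rightarrow> 'a set \<Rightarrow> bool" where
  "commutative_band m E \<longleftrightarrow>
     (\<forall>x\<in>E. \<forall>y\<in>E. m x y \<in> E) \<and> (\<forall>x\<in>E. m x x = x) \<and> (\<forall>x\<in>E. \<forall>y\<in>E. m x y = m y x)"

text \<open>
  The partition is represented by its set \<open>\<Omega>\<close> of blocks. The library predicate
  \<open>partition_on\<close> admits the empty partition of the empty set, whence the separate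
  requirement that \<open>H - C\<close> be nonempty.
\<close>

definition band_of_semigroups ::
  "'a set \<Rightarrow> ('a \<Rightarrow> 'a \<Rightarrow> 'a) \<Rightarrow> 'a set \<Rightarrow> 'a set set \<Rightarrow> bool" where
  "band_of_semigroups H m C \<Omega> \<longleftrightarrow>
     semigroup_ideal H m C \<and>
     H - C \<noteq> {} \<and> partition_on (H - C) \<Omega> \<and>
     (\<forall>A\<in>\<Omega>. subsemigroup H m A) \<and>
     (\<forall>A\<in>\<Omega>. \<forall>B\<in>\<Omega>. A \<noteq> B \<longrightarrow> (\<forall>a\<in>A. \<forall>b\<in>B. m a b \<in> C))"

definition class_H1 :: "'a set \<Rightarrow> ('a \<Rightarrow> 'a \<Rightarrow> 'a) \<Rightarrow> bool" where
  "class_H1 K m \<longleftrightarrow>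
     semigroup_on K m \<and>
     (at_least_two K \<longrightarrow> (\<exists>\<theta>. is_zero K m \<theta>)) \<and>
     (\<forall>x\<in>idempotents K m. \<forall>y\<in>idempotents K m. x \<noteq> y \<longrightarrow> is_zero K m (m x y)) \<and>
     (\<forall>i\<in>nontrivial_idempotents K m. \<forall>j\<in>nontrivial_idempotents K m.
        \<exists>!a. a \<in> K \<and> \<not> is_zero K m a \<and> a = m (m i a) j) \<and>
     (at_least_two K \<longrightarrow>
        (\<forall>a\<in>K. \<not> is_zero K m a \<longrightarrow>
           (\<exists>!p. p \<in> nontrivial_idempotents K m \<times> nontrivial_idempotents K m \<and>
                 a = m (m (fst p) a) (snd p))))"

definition group_of_order_two :: "'a set \<Rightarrow> ('a \<Rightarrow> 'a \<Rightarrow> 'a) \<Rightarrow> bool" where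
  "group_of_order_two A m \<longleftrightarrow>
     (\<exists>e. group \<lparr>carrier = A, mult = m, one = e\<rparr> \<and>
          order \<lparr>carrier = A, mult = m, one = e\<rparr> = 2)"

text \<open>
  In the two statements on pairs of nontrivial idempotents, ``exactly two distinct \<open>e1, e2\<close>''
  means that the unordered pair is unique. In the last condition, \<open>\<theta>\<close> is the zero of
  \<open>H\<close>.
\<close>

definition band_of_order_two_groups ::
  "'a set \<Rightarrow> ('a \<Rightarrow> 'a \<Rightarrow> 'a) \<Rightarrow> 'a set \<Rightarrow> 'a set set \<Rightarrow> bool" where
  "band_of_order_two_groups H m C \<Omega> \<longleftrightarrow>
     (let E = idempotents H m in
       band_of_semigroups H m C \<Omega> \<and>
       class_H1 C m \<and>
       (\<forall>A\<in>\<Omega>. group_of_order_two A m) \<and>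
       commutative_band m E \<and>
       (\<forall>e1\<in>nontrivial_idempotents C m. \<forall>e2\<in>nontrivial_idempotents C m. e1 \<noteq> e2 \<longrightarrow>
          (\<exists>!e. e \<in> E - C \<and> e1 = m e1 e \<and> e2 = m e2 e)) \<and>
       (\<forall>e\<in>E - C.
          \<exists>e1\<in>nontrivial_idempotents C m. \<exists>e2\<in>nontrivial_idempotents C m.
            e1 \<noteq> e2 \<and> e1 = m e1 e \<and> e2 = m e2 e \<and>
            (\<forall>f\<in>nontrivial_idempotents C m. f = m f e \<longrightarrow> f = e1 \<or> f = e2)) \<and>
       (\<forall>x\<in>E \<inter> C. \<forall>y\<in>H - E.
          (is_zero H m (m x y) \<longleftrightarrow> m x y \<in> E) \<and>
          (is_zero H m (m y x) \<longleftrightarrow> m y x \<in> E)))"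

text \<open>The blocks of the partition \<open>P \<otimes> P\<^sub>S\<close> of \<open>X \<times> X\<close>.\<close>

definition sym_product_partition :: "'x set set \<Rightarrow> ('x \<times> 'x) set set" where
  "sym_product_partition P = {(A \<times> B) \<union> (B \<times> A) | A B. A \<in> P \<and> B \<in> P}"

inductive_set generated_semigroup :: "('x \<times> 'x) set set \<Rightarrow> ('x \<times> 'x) set set"
  for Q :: "('x \<times> 'x) set set" where
  generator: "\<psi> \<in> Q \<Longrightarrow> \<psi> \<in> generated_semigroup Q"
| comp: "\<psi> \<in> generated_semigroup Q \<Longrightarrow> \<gamma> \<in> generated_semigroup Q \<Longrightarrow>
         \<psi> O \<gamma> \<in> generated_semigroup Q"

definition iso_to_partition_semigroup ::
  "'a set \<Rightarrow> ('a \<Rightarrow> 'a \<Rightarrow> 'a) \<Rightarrow> 'x set \<Rightarrow> 'x set set \<Rightarrow> bool" where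
  "iso_to_partition_semigroup H m X P \<longleftrightarrow>
     X \<noteq> {} \<and> partition_on X P \<and> at_least_two P \<and>
     semigroup_iso H m (generated_semigroup (sym_product_partition P)) (O)"

end

theory Submission
  imports Defs
begin

text \<open>
  Only the pattern of blocks matters: sending a relation \<open>R\<close> on an index set \<open>J\<close> of the blocks to
  the union of the products \<open>B i \<times> B j\<close>, \<open>(i, j) \<in> R\<close>, identifies the generated semigroup with the
  set of the relations \<open>{}\<close>, \<open>{(i, j)}\<close>, \<open>{(i, i), (j, j)}\<close>, \<open>{(i, j), (j, i)}\<close>. In this model the core
  consists of the relations with at most one pair, and the groups of order two are
  \<open>{{(i, i), (j, j)}, {(i, j), (j, i)}}\<close> with \<open>i \<noteq> j\<close>.

  Conversely, let \<open>N\<close> be the set of nontrivial idempotents of the core and represent \<open>h\<close> by the relation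
  \<open>{(i, j). i \<cdot> h \<cdot> j \<noteq> \<theta>}\<close> on \<open>N\<close>. Orthogonality of \<open>N\<close> makes this multiplicative as soon as
  \<open>c \<cdot> d \<noteq> \<theta>\<close> for nonzero core elements \<open>c = i \<cdot> c \<cdot> j\<close> and \<open>d = j \<cdot> d\<close>. The class \<open>H\<^sub>1\<close> alone does not
  give this; for \<open>i \<noteq> j\<close> the involution \<open>s\<close> in the group belonging to \<open>{i, j}\<close> does, because then
  \<open>c = i \<cdot> s\<close>, which \<open>j \<cdot> s\<close> cancels: \<open>j \<cdot> s \<cdot> c \<cdot> d = d\<close>.
\<close>

section \<open>The index model: relations on an index set with at most two pairs\<close>

definition pair_relations :: "'i set \<Rightarrow> ('i \<times> 'i) set set" where
  "pair_relations J =
     insert {} ({{(i, j)} | i j. i \<in> J \<and> j \<in> J} \<union>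
       {{(i, i), (j, j)} | i j. i \<in> J \<and> j \<in> J} \<union>
       {{(i, j), (j, i)} | i j. i \<in> J \<and> j \<in> J})"

lemma pair_relations_intros [simp]:
  "{} \<in> pair_relations J"
  "i \<in> J \<Longrightarrow> j \<in> J \<Longrightarrow> {(i, j)} \<in> pair_relations J"
  "i \<in> J \<Longrightarrow> j \<in> J \<Longrightarrow> {(i, i), (j, j)} \<in> pair_relations J"
  "i \<in> J \<Longrightarrow> j \<in> J \<Longrightarrow> {(i, j), (j, i)} \<in> pair_relations J"
  unfolding pair_relations_def by blast+

text \<open>The instances with \<open>i = j\<close> of the two-pair shapes are singletons. They are
  moved to the \<open>unit\<close> case, so that \<open>diag\<close> and \<open>swap\<close> really
  have two pairs.\<close>

lemma pair_relations_cases [consumes 1, case_names empty unit diag swap]: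
  assumes "R \<in> pair_relations J"
  obtains "R = {}"
  | i j where "i \<in> J" "j \<in> J" "R = {(i, j)}"
  | i j where "i \<in> J" "j \<in> J" "i \<noteq> j" "R = {(i, i), (j, j)}"
  | i j where "i \<in> J" "j \<in> J" "i \<noteq> j" "R = {(i, j), (j, i)}"
proof -
  have "R = {} \<or> (\<exists>i\<in>J. \<exists>j\<in>J. R = {(i, j)}) \<or> (\<exists>i\<in>J. \<exists>j\<in>J. R = {(i, i), (j, j)}) \<or>
      (\<exists>i\<in>J. \<exists>j\<in>J. R = {(i, j), (j, i)})"
    using assms unfolding pair_relations_def by (simp add: Bex_def conj_ac)
  then consider "R = {}" | i j where "i \<in> J" "j \<in> J" "R = {(i, j)}"
    | i j where "i \<in> J" "j \<in> J" "R = {(i, i), (j, j)}"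
    | i j where "i \<in> J" "j \<in> J" "R = {(i, j), (j, i)}"
    by metis
  then show thesis
  proof cases
    case 1
    then show ?thesis by (rule that(1))
  next
    case (2 i j)
    then show ?thesis by (rule that(2))
  next
    case (3 i j)
    then show ?thesis
      by (cases "i = j") (simp_all add: that(2)[of i i] that(3)[of i j])
  next
    case (4 i j)
    then show ?thesis
      by (cases "i = j") (simp_all add: that(2)[of i i] that(4)[of i j])
  qed
qed

text \<open>Together with the next rule this evaluates compositions of explicitly listed finite
  relations by rewriting, branching on equality of indices.\<close>

lemma insert_relcomp: "insert (a, b) R O S = Pair a ` (S `` {b}) \<union> (R O S)"
  by auto

lemma insert_Image_singleton:
  "insert (c, d) S `` {b} = (if b = c then insert d (S `` {b}) else S `` {b})"
  by auto

lemma pair_relations_subset: "R \<in> pair_relations J \<Longrightarrow> R \<subseteq> J \<times> J"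
  by (auto elim: pair_relations_cases)

text \<open>All members are partial injections. Two members with two pairs each compose to another
  such member if they use the same two indices; otherwise they share at most one index and at most
  one pair survives. A factor with at most one pair leaves at most one.\<close>

lemma pair_relations_relcomp:
  assumes R: "R \<in> pair_relations J" and S: "S \<in> pair_relations J"
  shows "R O S \<in> pair_relations J"
  using R
proof (cases rule: pair_relations_cases)
  case empty
  then show ?thesis by simp
next
  case (unit i j)
  show ?thesis using S
    by (cases rule: pair_relations_cases) (auto simp: unit insert_relcomp insert_Image_singleton)
next
  case (diag i j)
  show ?thesis using S
    by (cases rule: pair_relations_cases) (auto simp: diag insert_relcomp insert_Image_singleton insert_commute)
next
  case (swap i j)
  show ?thesis using S
    by (cases rule: pair_relations_cases) (auto simp: swap insert_relcomp insert_Image_singleton insert_commute)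
qed

section \<open>From relations between blocks to relations between points\<close>

definition blow_up :: "('i \<Rightarrow> 'x set) \<Rightarrow> ('i \<times> 'i) set \<Rightarrow> ('x \<times> 'x) set" where
  "blow_up B R = (\<Union>(i, j)\<in>R. B i \<times> B j)"

lemma mem_blow_up: "(x, y) \<in> blow_up B R \<longleftrightarrow> (\<exists>i j. (i, j) \<in> R \<and> x \<in> B i \<and> y \<in> B j)"
  unfolding blow_up_def by auto

text \<open>Compose with \<open>g\<close> in one direction and with its inverse on the image in the
  other. This lets the generated semigroup be replaced by the index model.\<close>

lemma semigroup_iso_image_iff:
  assumes inj: "inj_on g K"
    and hom: "\<And>x y. x \<in> K \<Longrightarrow> y \<in> K \<Longrightarrow> n x y \<in> K \<and> g (n x y) = k (g x) (g y)"
  shows "semigroup_iso H m (g ` K) k \<longleftrightarrow> semigroup_iso H m K n"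
proof
  assume "semigroup_iso H m (g ` K) k"
  then obtain f where f: "bij_betw f H (g ` K)"
    "\<And>x y. x \<in> H \<Longrightarrow> y \<in> H \<Longrightarrow> f (m x y) = k (f x) (f y)"
    unfolding semigroup_iso_def by blast
  define f' where "f' = inv_into K g \<circ> f"
  have "bij_betw f' H K"
    unfolding f'_def by (rule bij_betw_trans[OF f(1)]) (simp add: inj inj_on_imp_bij_betw bij_betw_inv_into)
  moreover have "f' (m x y) = n (f' x) (f' y)" if "x \<in> H" "y \<in> H" for x y
  proof -
    have "f x \<in> g ` K" "f y \<in> g ` K"
      using bij_betwE[OF f(1)] that by simp_all
    then obtain a b where ab: "a \<in> K" "b \<in> K" "f x = g a" "f y = g b"
      by blast
    then have "f (m x y) = g (n a b)" "n a b \<in> K"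
      using f(2)[OF that] hom[of a b] by simp_all
    then show ?thesis
      using ab inj by (simp add: f'_def)
  qed
  ultimately show "semigroup_iso H m K n"
    unfolding semigroup_iso_def by blast
next
  assume "semigroup_iso H m K n"
  then obtain f where f: "bij_betw f H K"
    "\<And>x y. x \<in> H \<Longrightarrow> y \<in> H \<Longrightarrow> f (m x y) = n (f x) (f y)"
    unfolding semigroup_iso_def by blast
  have "bij_betw (g \<circ> f) H (g ` K)"
    using f(1) inj by (rule bij_betw_trans[OF _ inj_on_imp_bij_betw])
  moreover have "(g \<circ> f) (m x y) = k ((g \<circ> f) x) ((g \<circ> f) y)" if "x \<in> H" "y \<in> H" for x y
    using f that hom by (auto simp: bij_betw_def)
  ultimately show "semigroup_iso H m (g ` K) k"
    unfolding semigroup_iso_def by blast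
qed

context
  fixes B :: "'i \<Rightarrow> 'x set" and J :: "'i set"
  assumes nonempty: "\<And>i. i \<in> J \<Longrightarrow> B i \<noteq> {}"
    and disjoint: "\<And>i j. i \<in> J \<Longrightarrow> j \<in> J \<Longrightarrow> i \<noteq> j \<Longrightarrow> B i \<inter> B j = {}"
begin

text \<open>Nonempty blocks supply the intermediate point for one inclusion; disjoint blocks force
  the two middle indices to agree for the other.\<close>

lemma blow_up_relcomp:
  assumes "R \<subseteq> J \<times> J" "S \<subseteq> J \<times> J"
  shows "blow_up B (R O S) = blow_up B R O blow_up B S"
proof (intro subset_antisym subrelI)
  fix x y assume "(x, y) \<in> blow_up B (R O S)"
  then obtain i j k where ijk: "(i, j) \<in> R" "(j, k) \<in> S" "x \<in> B i" "y \<in> B k"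
    unfolding mem_blow_up by blast
  then obtain z where "z \<in> B j" using assms nonempty[of j] by blast
  with ijk show "(x, y) \<in> blow_up B R O blow_up B S"
    unfolding relcomp_unfold by (auto simp: mem_blow_up)
next
  fix x z assume "(x, z) \<in> blow_up B R O blow_up B S"
  then obtain y where "(x, y) \<in> blow_up B R" "(y, z) \<in> blow_up B S" by blast
  then obtain i j j' k where *: "(i, j) \<in> R" "(j', k) \<in> S" "x \<in> B i" "y \<in> B j" "y \<in> B j'" "z \<in> B k"
    unfolding mem_blow_up by blast
  then have "j = j'" using assms disjoint[of j j'] by blast
  with * show "(x, z) \<in> blow_up B (R O S)" unfolding mem_blow_up by blast
qed

text \<open>A point of \<open>B i \<times> B j\<close> exists and lies in no other product of
  blocks, so it witnesses whether \<open>(i, j)\<close> belongs to the relation.\<close>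

lemma inj_on_blow_up: "inj_on (blow_up B) (Pow (J \<times> J))"
proof (rule inj_onI)
  have *: "(i, j) \<in> S"
    if "R \<subseteq> J \<times> J" "S \<subseteq> J \<times> J" "blow_up B R = blow_up B S" "(i, j) \<in> R" for R S i j
  proof -
    have "i \<in> J" "j \<in> J" using that by blast+
    then obtain x y where xy: "x \<in> B i" "y \<in> B j" using nonempty by (meson ex_in_conv)
    with that have "(x, y) \<in> blow_up B S" by (metis mem_blow_up)
    then obtain i' j' where ij: "(i', j') \<in> S" "x \<in> B i'" "y \<in> B j'" unfolding mem_blow_up by blast
    then have "i = i'" "j = j'" using xy that disjoint[of i i'] disjoint[of j j'] by blast+
    with ij show ?thesis by simp
  qed
  fix R S assume "R \<in> Pow (J \<times> J)" "S \<in> Pow (J \<times> J)" "blow_up B R = blow_up B S"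
  then show "R = S" using *[of R S] *[of S R] by auto
qed

text \<open>The generators correspond to \<open>{(i, j), (j, i)}\<close>. Squaring such a relation
  gives \<open>{(i, i), (j, j)}\<close>, multiplying it by \<open>{(i, i)}\<close> on the left gives
  \<open>{(i, j)}\<close>, and the empty relation is the product of \<open>{(a, a)}\<close> and
  \<open>{(b, b)}\<close> for distinct \<open>a\<close>, \<open>b\<close>.\<close>

lemma generated_semigroup_eq_blow_up:
  assumes two: "at_least_two J"
  shows "generated_semigroup (sym_product_partition (B ` J)) = blow_up B ` pair_relations J"
proof (intro equalityI subsetI)
  fix \<psi> assume "\<psi> \<in> generated_semigroup (sym_product_partition (B ` J))"
  then show "\<psi> \<in> blow_up B ` pair_relations J"
  proof induction
    case (generator \<psi>)
    then obtain i j where ij: "i \<in> J" "j \<in> J" "\<psi> = B i \<times> B j \<union> B j \<times> B i"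
      unfolding sym_product_partition_def by blast
    then have *: "\<psi> = blow_up B {(i, j), (j, i)}" by (auto simp: blow_up_def)
    show ?case by (subst *) (simp add: ij(1,2) imageI)
  next
    case (comp \<psi> \<gamma>)
    then obtain R S where "R \<in> pair_relations J" "S \<in> pair_relations J"
      "\<psi> = blow_up B R" "\<gamma> = blow_up B S" by blast
    then show ?case
      using pair_relations_relcomp blow_up_relcomp pair_relations_subset by (metis image_eqI)
  qed
next
  let ?G = "generated_semigroup (sym_product_partition (B ` J))"
  let ?g = "blow_up B"
  have swap: "?g {(i, j), (j, i)} \<in> ?G" if "i \<in> J" "j \<in> J" for i j
    by (rule generator) (use that in \<open>auto simp: sym_product_partition_def blow_up_def\<close>)
  have comp': "?g (R O S) \<in> ?G" if "?g R \<in> ?G" "?g S \<in> ?G" "R \<subseteq> J \<times> J" "S \<subseteq> J \<times> J" for R S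
    using that by (simp add: blow_up_relcomp comp)
  have idem: "?g {(i, i)} \<in> ?G" if "i \<in> J" for i
    using swap[of i i] that by simp
  have diag: "?g {(i, i), (j, j)} \<in> ?G" if "i \<in> J" "j \<in> J" for i j
  proof -
    have "{(i, j), (j, i)} O {(i, j), (j, i)} = {(i, i), (j, j)}" by auto
    with comp'[OF swap swap, of i j i j] that show ?thesis by auto
  qed
  have unit: "?g {(i, j)} \<in> ?G" if "i \<in> J" "j \<in> J" for i j
  proof -
    have "{(i, i)} O {(i, j), (j, i)} = {(i, j)}" by auto
    with comp'[OF idem swap, of i i j] that show ?thesis by auto
  qed
  obtain a b where "a \<in> J" "b \<in> J" "a \<noteq> b" using two unfolding at_least_two_def by blast
  then have empty: "?g {} \<in> ?G"
    using comp'[OF idem idem, of a b] by (auto simp: insert_relcomp insert_Image_singleton)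
  fix \<psi> assume "\<psi> \<in> ?g ` pair_relations J"
  then obtain R where "R \<in> pair_relations J" "\<psi> = ?g R" by blast
  then show "\<psi> \<in> ?G"
    by (cases rule: pair_relations_cases) (auto simp: empty unit diag swap)
qed

lemma semigroup_iso_generated_iff:
  assumes "at_least_two J"
  shows "semigroup_iso H m (generated_semigroup (sym_product_partition (B ` J))) (O) \<longleftrightarrow>
    semigroup_iso H m (pair_relations J) (O)"
  unfolding generated_semigroup_eq_blow_up[OF assms]
proof (rule semigroup_iso_image_iff)
  show "inj_on (blow_up B) (pair_relations J)"
    by (rule inj_on_subset[OF inj_on_blow_up]) (auto dest: pair_relations_subset)
qed (simp add: pair_relations_relcomp blow_up_relcomp pair_relations_subset)

end

section \<open>From the index model to the band conditions\<close>

locale pair_relation_model =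
  fixes H :: "'a set" and m :: "'a \<Rightarrow> 'a \<Rightarrow> 'a" and J :: "'i set" and f :: "'a \<Rightarrow> ('i \<times> 'i) set"
  assumes semigroup: "semigroup_on H m"
    and two: "at_least_two J"
    and bij: "bij_betw f H (pair_relations J)"
    and hom: "\<And>x y. x \<in> H \<Longrightarrow> y \<in> H \<Longrightarrow> f (m x y) = f x O f y"
begin

lemma closed [simp]: "x \<in> H \<Longrightarrow> y \<in> H \<Longrightarrow> m x y \<in> H"
  using semigroup unfolding semigroup_on_def by blast

lemma assoc: "x \<in> H \<Longrightarrow> y \<in> H \<Longrightarrow> z \<in> H \<Longrightarrow> m (m x y) z = m x (m y z)"
  using semigroup unfolding semigroup_on_def by blast

lemma f_mem: "x \<in> H \<Longrightarrow> f x \<in> pair_relations J"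
  using bij unfolding bij_betw_def by blast

lemma eq_iff: "x \<in> H \<Longrightarrow> y \<in> H \<Longrightarrow> x = y \<longleftrightarrow> f x = f y"
  using bij unfolding bij_betw_def inj_on_def by blast

lemma obtain_preimage:
  assumes "R \<in> pair_relations J"
  obtains x where "x \<in> H" "f x = R"
proof -
  have "R \<in> f ` H" using assms bij_betw_imp_surj_on[OF bij] by simp
  then show thesis using that by blast
qed

definition core :: "'a set" where
  "core = {x \<in> H. f x = {} \<or> (\<exists>i\<in>J. \<exists>j\<in>J. f x = {(i, j)})}"

definition block :: "'i \<Rightarrow> 'i \<Rightarrow> 'a set" where
  "block i j = {x \<in> H. f x = {(i, i), (j, j)} \<or> f x = {(i, j), (j, i)}}"

definition blocks :: "'a set set" where
  "blocks = {block i j | i j. i \<in> J \<and> j \<in> J \<and> i \<noteq> j}"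

lemma core_subset: "core \<subseteq> H"
  unfolding core_def by blast

text \<open>A unit off the diagonal squares to the empty relation and a swap squares to a diagonal
  relation, so exactly the partial identities remain.\<close>

lemma idempotents_iff: "x \<in> idempotents H m \<longleftrightarrow> x \<in> H \<and> f x \<subseteq> Id"
proof -
  have "f x O f x = f x \<longleftrightarrow> f x \<subseteq> Id" if "x \<in> H"
    using f_mem[OF that] by (cases rule: pair_relations_cases) (auto simp: insert_relcomp insert_Image_singleton)
  then show ?thesis
    unfolding idempotents_def by (auto simp: eq_iff hom)
qed

lemma obtain_two:
  obtains a b where "a \<in> J" "b \<in> J" "a \<noteq> b"
  using two unfolding at_least_two_def by blast

text \<open>Stated for every set between \<open>core\<close> and \<open>H\<close>, so that it
  describes the zero of the core and the zero of \<open>H\<close> at once.\<close>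

lemma zero_iff:
  assumes "core \<subseteq> A" "A \<subseteq> H"
  shows "is_zero A m x \<longleftrightarrow> x \<in> H \<and> f x = {}"
proof -
  obtain z where z: "z \<in> H" "f z = {}" by (rule obtain_preimage) auto
  obtain a b where ab: "a \<in> J" "b \<in> J" "a \<noteq> b" by (rule obtain_two)
  obtain u where u: "u \<in> H" "f u = {(a, b)}" using ab obtain_preimage[of "{(a,b)}"] by auto
  have zu: "z \<in> A" "u \<in> A" using assms z u ab unfolding core_def by blast+
  have "z \<noteq> u" using z u by auto
  with zu have two': "at_least_two A" unfolding at_least_two_def by blast
  have mz: "m z s = z \<and> m s z = z" if "s \<in> A" for s
    using that assms z by (auto simp: eq_iff hom subset_iff)
  have "is_zero A m z" using two' zu mz unfolding is_zero_def by blast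
  moreover have "x = z" if "is_zero A m x" using that zu mz unfolding is_zero_def by metis
  ultimately show ?thesis using z eq_iff by metis
qed

text \<open>An element with relation \<open>{(i, i)}\<close> annihilates the one with
  \<open>{(j, j)}\<close> for another index \<open>j\<close>, hence is not an identity of the
  core.\<close>

lemma nontrivial_idempotents_core_iff:
  "x \<in> nontrivial_idempotents core m \<longleftrightarrow> x \<in> H \<and> (\<exists>i\<in>J. f x = {(i, i)})"
proof -
  have "\<not> is_identity core m x" if x: "x \<in> H" "f x = {(i, i)}" "i \<in> J" for i
  proof
    assume id: "is_identity core m x"
    obtain j where j: "j \<in> J" "j \<noteq> i" using obtain_two by metis
    then obtain u where u: "u \<in> H" "f u = {(j, j)}" using obtain_preimage[of "{(j,j)}"] by auto
    then have "u \<in> core" using j unfolding core_def by blast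
    then have "m x u = u" using id unfolding is_identity_def by blast
    then have "f x O f u = f u" using hom[of x u] x u by simp
    then show False using j x u by auto
  qed
  moreover have "x \<in> idempotents core m \<longleftrightarrow> x \<in> core \<and> f x \<subseteq> Id"
    using idempotents_iff[of x] core_subset unfolding idempotents_def by blast
  ultimately show ?thesis
    unfolding nontrivial_idempotents_def by (auto simp: zero_iff core_subset core_def)
qed

text \<open>Composing with a partial injection cannot increase the number of pairs.\<close>

lemma ideal_core: "semigroup_ideal H m core"
proof -
  have "m c h \<in> core \<and> m h c \<in> core" if c: "c \<in> core" and h: "h \<in> H" for c h
    using f_mem[OF h]
    by (cases rule: pair_relations_cases)
       (use c h in \<open>auto simp: core_def hom insert_relcomp insert_Image_singleton\<close>)
  moreover obtain z where "z \<in> H" "f z = {}" using obtain_preimage[of "{}"] by auto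
  then have "core \<noteq> {}" unfolding core_def by blast
  ultimately show ?thesis
    unfolding semigroup_ideal_def subsemigroup_def using core_subset by blast
qed

lemma not_core_iff:
  "x \<in> H - core \<longleftrightarrow> (\<exists>i\<in>J. \<exists>j\<in>J. i \<noteq> j \<and> x \<in> block i j)"
proof
  assume x: "x \<in> H - core"
  then have "f x \<in> pair_relations J" by (simp add: f_mem)
  then show "\<exists>i\<in>J. \<exists>j\<in>J. i \<noteq> j \<and> x \<in> block i j"
    by (cases rule: pair_relations_cases) (use x in \<open>auto simp: core_def block_def\<close>)
next
  assume "\<exists>i\<in>J. \<exists>j\<in>J. i \<noteq> j \<and> x \<in> block i j"
  then show "x \<in> H - core" by (auto simp: core_def block_def)
qed

lemma group_block:
  assumes "i \<in> J" "j \<in> J" "i \<noteq> j"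
  shows "group_of_order_two (block i j) m"
proof -
  obtain e where e: "e \<in> H" "f e = {(i, i), (j, j)}"
    using assms obtain_preimage[of "{(i, i), (j, j)}"] by auto
  obtain s where s: "s \<in> H" "f s = {(i, j), (j, i)}"
    using assms obtain_preimage[of "{(i, j), (j, i)}"] by auto
  have ne: "e \<noteq> s" using e s assms by auto
  have block: "block i j = {e, s}"
    using e s by (auto simp: block_def eq_iff)
  have mult: "m e e = e" "m e s = s" "m s e = s" "m s s = e"
    using e s by (auto simp: eq_iff hom insert_relcomp insert_Image_singleton)
  have "group \<lparr>carrier = {e, s}, mult = m, one = e\<rparr>"
    by (rule groupI) (auto simp: mult)
  then show ?thesis
    unfolding group_of_order_two_def block order_def using ne by (intro exI[of _ e]) simp
qed

lemma block_commute: "block i j = block j i"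
  unfolding block_def by (simp add: insert_commute)

text \<open>Different blocks belong to different unordered index pairs. These share at most one
  index, and only a shared index can contribute a pair to the product.\<close>

lemma mult_blocks:
  assumes "i \<noteq> j" "k \<noteq> l" "i \<in> J" "j \<in> J" "k \<in> J" "l \<in> J"
    and ne: "block i j \<noteq> block k l" and x: "x \<in> block i j" and y: "y \<in> block k l"
  shows "m x y \<in> core"
proof -
  have ne': "\<not> (i = k \<and> j = l)" "\<not> (i = l \<and> j = k)"
    using ne block_commute by blast+
  have fx: "f x = {(i, i), (j, j)} \<or> f x = {(i, j), (j, i)}"
    and fy: "f y = {(k, k), (l, l)} \<or> f y = {(k, l), (l, k)}"
    and xy: "x \<in> H" "y \<in> H"
    using x y by (simp_all add: block_def)
  have "f x O f y = {} \<or> (\<exists>p\<in>J. \<exists>q\<in>J. f x O f y = {(p, q)})"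
    using fx fy
    by (elim disjE; cases "i = k"; cases "i = l"; cases "j = k"; cases "j = l")
      (use assms(1-6) ne' in \<open>simp_all add: insert_relcomp insert_Image_singleton\<close>)
  then show ?thesis
    using xy by (simp add: core_def hom)
qed

text \<open>Both kinds of element of a block have the unordered index pair as their domain.\<close>

lemma disjoint_blocks:
  assumes "x \<in> block i j" "x \<in> block k l"
  shows "block i j = block k l"
proof -
  have "Domain (f x) = {i, j}" "Domain (f x) = {k, l}"
    using assms by (auto simp: block_def)
  then have "i = k \<and> j = l \<or> i = l \<and> j = k"
    by (metis doubleton_eq_iff)
  then show ?thesis using block_commute by blast
qed

lemma subsemigroup_group_of_order_two:
  assumes "group_of_order_two A m" "A \<subseteq> H"
  shows "subsemigroup H m A"
proof -
  obtain e where "group \<lparr>carrier = A, mult = m, one = e\<rparr>"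
    using assms(1) unfolding group_of_order_two_def by blast
  then interpret group "\<lparr>carrier = A, mult = m, one = e\<rparr>" .
  show ?thesis
    unfolding subsemigroup_def using assms(2) m_closed one_closed by auto
qed

lemma band_blocks: "band_of_semigroups H m core blocks"
  unfolding band_of_semigroups_def
proof (intro conjI ballI impI)
  show "semigroup_ideal H m core" by (rule ideal_core)
  show "H - core \<noteq> {}"
  proof -
    obtain a b where ab: "a \<in> J" "b \<in> J" "a \<noteq> b" by (rule obtain_two)
    obtain x where "x \<in> H" "f x = {(a, a), (b, b)}"
      using ab obtain_preimage[of "{(a, a), (b, b)}"] by auto
    then show ?thesis using ab not_core_iff[of x] by (auto simp: block_def)
  qed
  show "partition_on (H - core) blocks"
  proof (rule partition_onI)
    show "\<Union>blocks = H - core"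
      unfolding blocks_def using not_core_iff by blast
    show "disjnt p q" if "p \<in> blocks" "q \<in> blocks" "p \<noteq> q" for p q
      using that disjoint_blocks unfolding blocks_def disjnt_def by blast
    have "block i j \<noteq> {}" if ij: "i \<in> J" "j \<in> J" for i j
    proof -
      obtain x where "x \<in> H" "f x = {(i, i), (j, j)}"
        using ij obtain_preimage[of "{(i, i), (j, j)}"] by auto
      then show ?thesis unfolding block_def by blast
    qed
    then show "{} \<notin> blocks" unfolding blocks_def by auto
  qed
  show "subsemigroup H m A" if "A \<in> blocks" for A
    using that subsemigroup_group_of_order_two group_block
    unfolding blocks_def block_def by blast
  show "m a b \<in> core" if "A \<in> blocks" "B \<in> blocks" "A \<noteq> B" "a \<in> A" "b \<in> B" for A B a b
    using that mult_blocks unfolding blocks_def by blast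
qed

text \<open>Nonzero core elements behave like matrix units: \<open>{(p, q)}\<close> is the only
  nonempty relation fixed by \<open>{(p, p)}\<close> on the left and \<open>{(q, q)}\<close> on the
  right, and these two idempotents are read off from its domain and range.\<close>

lemma class_H1_core: "class_H1 core m"
  unfolding class_H1_def
proof (intro conjI ballI impI)
  have core: "x \<in> H" if "x \<in> core" for x using that core_subset by blast
  show "semigroup_on core m"
    using ideal_core assoc core unfolding semigroup_on_def semigroup_ideal_def subsemigroup_def by metis
  obtain z where "z \<in> H" "f z = {}" using obtain_preimage[of "{}"] by auto
  then show "\<exists>\<theta>. is_zero core m \<theta>"
    using zero_iff[OF order_refl core_subset] by blast
  show "is_zero core m (m x y)"
    if "x \<in> idempotents core m" "y \<in> idempotents core m" "x \<noteq> y" for x y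
  proof -
    have x: "x \<in> core" "f x \<subseteq> Id" and y: "y \<in> core" "f y \<subseteq> Id"
      using that idempotents_iff[of x] idempotents_iff[of y] core unfolding idempotents_def by auto
    then have "f x O f y = {}"
      using that(3) eq_iff[of x y] by (auto simp: core_def insert_relcomp insert_Image_singleton)
    then show ?thesis using core x y by (simp add: zero_iff core_subset hom)
  qed
  show "\<exists>!a. a \<in> core \<and> \<not> is_zero core m a \<and> a = m (m i a) j"
    if ij: "i \<in> nontrivial_idempotents core m" "j \<in> nontrivial_idempotents core m" for i j
  proof -
    obtain p q where p: "i \<in> H" "p \<in> J" "f i = {(p, p)}" and q: "j \<in> H" "q \<in> J" "f j = {(q, q)}"
      using ij by (auto simp: nontrivial_idempotents_core_iff)
    obtain a where a: "a \<in> H" "f a = {(p, q)}" using p q obtain_preimage[of "{(p,q)}"] by auto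
    show ?thesis
    proof (rule ex1I[of _ a])
      show "a \<in> core \<and> \<not> is_zero core m a \<and> a = m (m i a) j"
        using a p q by (auto simp: core_def zero_iff core_subset hom eq_iff insert_relcomp insert_Image_singleton)
      show "b = a" if "b \<in> core \<and> \<not> is_zero core m b \<and> b = m (m i b) j" for b
      proof -
        have b: "b \<in> H" "f b = (f i O f b) O f j" "f b \<noteq> {}"
          using that core p q hom by (auto simp: zero_iff core_subset) (metis closed hom)+
        then have "f b = {(p, q)}" using p q by auto
        then show ?thesis using a b eq_iff by simp
      qed
    qed
  qed
  show "\<exists>!p. p \<in> nontrivial_idempotents core m \<times> nontrivial_idempotents core m \<and>
            a = m (m (fst p) a) (snd p)"
    if a0: "a \<in> core" "\<not> is_zero core m a" for a
  proof -
    obtain k l where a: "a \<in> H" "k \<in> J" "l \<in> J" "f a = {(k, l)}"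
      using a0 by (auto simp: zero_iff core_subset core_def)
    obtain i where i: "i \<in> H" "f i = {(k, k)}" using a obtain_preimage[of "{(k,k)}"] by auto
    obtain j where j: "j \<in> H" "f j = {(l, l)}" using a obtain_preimage[of "{(l,l)}"] by auto
    show ?thesis
    proof (rule ex1I[of _ "(i, j)"])
      show "(i, j) \<in> nontrivial_idempotents core m \<times> nontrivial_idempotents core m \<and>
            a = m (m (fst (i, j)) a) (snd (i, j))"
        using a i j by (auto simp: nontrivial_idempotents_core_iff hom eq_iff insert_relcomp insert_Image_singleton)
      fix p assume p: "p \<in> nontrivial_idempotents core m \<times> nontrivial_idempotents core m \<and>
            a = m (m (fst p) a) (snd p)"
      then obtain i' j' k' l' where p': "p = (i', j')" "i' \<in> H" "j' \<in> H"
        "f i' = {(k', k')}" "f j' = {(l', l')}" "a = m (m i' a) j'"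
        by (cases p) (auto simp: nontrivial_idempotents_core_iff)
      then have "f a = (f i' O f a) O f j'" using a hom closed by metis
      then have "k' = k" "l' = l" using a p' by auto
      then show "p = (i, j)" using p' i j eq_iff by simp
    qed
  qed
qed

lemma idempotents_not_core_iff:
  "e \<in> idempotents H m - core \<longleftrightarrow> e \<in> H \<and> (\<exists>i\<in>J. \<exists>j\<in>J. i \<noteq> j \<and> f e = {(i, i), (j, j)})"
  using idempotents_iff[of e] not_core_iff[of e] by (auto simp: block_def)

text \<open>Composition of partial identities is intersection, hence commutative. The relation
  \<open>{(k, k)}\<close> is fixed by \<open>{(i, i), (j, j)}\<close> exactly when \<open>k\<close>
  is \<open>i\<close> or \<open>j\<close>, which yields the correspondence between outer idempotents
  and unordered pairs of core idempotents.\<close>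

lemma band_of_order_two_groups_core: "band_of_order_two_groups H m core blocks"
  unfolding band_of_order_two_groups_def Let_def
proof (intro conjI ballI impI)
  show "band_of_semigroups H m core blocks" by (rule band_blocks)
  show "class_H1 core m" by (rule class_H1_core)
  show "group_of_order_two A m" if "A \<in> blocks" for A
    using that group_block unfolding blocks_def by blast
  show "commutative_band m (idempotents H m)"
  proof -
    have "f x O f y \<subseteq> Id \<and> f x O f y = f y O f x" if "f x \<subseteq> Id" "f y \<subseteq> Id" for x y
      using that by blast
    then show ?thesis
      unfolding commutative_band_def Ball_def idempotents_iff
      by (auto simp: hom eq_iff idempotents_def)
  qed
  show "\<exists>!e. e \<in> idempotents H m - core \<and> e1 = m e1 e \<and> e2 = m e2 e"
    if e12: "e1 \<in> nontrivial_idempotents core m" "e2 \<in> nontrivial_idempotents core m" "e1 \<noteq> e2" for e1 e2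
  proof -
    obtain i j where i: "e1 \<in> H" "i \<in> J" "f e1 = {(i, i)}" and j: "e2 \<in> H" "j \<in> J" "f e2 = {(j, j)}"
      using e12 by (auto simp: nontrivial_idempotents_core_iff)
    then have ij: "i \<noteq> j" using e12 eq_iff by auto
    obtain e where e: "e \<in> H" "f e = {(i, i), (j, j)}"
      using i j obtain_preimage[of "{(i, i), (j, j)}"] by auto
    show ?thesis
    proof (rule ex1I[of _ e])
      show "e \<in> idempotents H m - core \<and> e1 = m e1 e \<and> e2 = m e2 e"
        unfolding idempotents_not_core_iff using e i j ij by (auto simp: eq_iff hom insert_relcomp insert_Image_singleton)
      fix e' assume e': "e' \<in> idempotents H m - core \<and> e1 = m e1 e' \<and> e2 = m e2 e'"
      then obtain k l where kl: "e' \<in> H" "f e' = {(k, k), (l, l)}"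
        unfolding idempotents_not_core_iff by blast
      have "f e1 = f e1 O f e'" "f e2 = f e2 O f e'" using e' kl i j hom by metis+
      then have "i = k \<or> i = l" "j = k \<or> j = l" using i j kl by auto
      then have "f e' = f e" using kl e ij by auto
      then show "e' = e" using e kl eq_iff by simp
    qed
  qed
  show "\<exists>e1\<in>nontrivial_idempotents core m. \<exists>e2\<in>nontrivial_idempotents core m.
            e1 \<noteq> e2 \<and> e1 = m e1 e \<and> e2 = m e2 e \<and>
            (\<forall>f\<in>nontrivial_idempotents core m. f = m f e \<longrightarrow> f = e1 \<or> f = e2)"
    if e0: "e \<in> idempotents H m - core" for e
  proof -
    obtain i j where e: "e \<in> H" "i \<in> J" "j \<in> J" "i \<noteq> j" "f e = {(i, i), (j, j)}"
      using e0 idempotents_not_core_iff by blast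
    obtain e1 where e1: "e1 \<in> H" "f e1 = {(i, i)}" using e obtain_preimage[of "{(i,i)}"] by auto
    obtain e2 where e2: "e2 \<in> H" "f e2 = {(j, j)}" using e obtain_preimage[of "{(j,j)}"] by auto
    show ?thesis
    proof (rule bexI[of _ e1], rule bexI[of _ e2], intro conjI ballI impI)
      show "e1 \<in> nontrivial_idempotents core m" "e2 \<in> nontrivial_idempotents core m"
        using e e1 e2 by (auto simp: nontrivial_idempotents_core_iff)
      show "e1 \<noteq> e2" "e1 = m e1 e" "e2 = m e2 e"
        using e e1 e2 by (auto simp: eq_iff hom insert_relcomp insert_Image_singleton)
      fix g assume g: "g \<in> nontrivial_idempotents core m" "g = m g e"
      then obtain k where k: "g \<in> H" "f g = {(k, k)}" by (auto simp: nontrivial_idempotents_core_iff)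
      have "f g = f g O f e" using g k e hom by metis
      then have "k = i \<or> k = j" using k e by auto
      then show "g = e1 \<or> g = e2" using k e1 e2 eq_iff by auto
    qed
  qed
  fix x y assume x: "x \<in> idempotents H m \<inter> core" and y: "y \<in> H - idempotents H m"
  have xH: "x \<in> H" "f x = {} \<or> (\<exists>i\<in>J. f x = {(i, i)})"
    using x idempotents_iff[of x] by (auto simp: core_def)
  have yH: "y \<in> H" "\<not> f y \<subseteq> Id" using y idempotents_iff[of y] by auto
  from yH(1) have "f y \<in> pair_relations J" by (rule f_mem)
  \<comment> \<open>As \<open>y\<close> is not idempotent, \<open>f y\<close> consists of one or two
    pairs off the diagonal. Composing with \<open>f x\<close> keeps at most one of them, so the
    result is a partial identity only when empty.\<close>
  then have "(f x O f y = {} \<longleftrightarrow> f x O f y \<subseteq> Id) \<and> (f y O f x = {} \<longleftrightarrow> f y O f x \<subseteq> Id)"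
    by (cases rule: pair_relations_cases) (use xH yH in auto)
  then show "is_zero H m (m x y) \<longleftrightarrow> m x y \<in> idempotents H m"
    "is_zero H m (m y x) \<longleftrightarrow> m y x \<in> idempotents H m"
    using xH yH by (auto simp: zero_iff core_subset idempotents_iff hom)
qed

end

text \<open>Every block serves as its own index: the index set is \<open>P\<close> and the family of
  blocks is \<open>id\<close>.\<close>

lemma iso_to_partition_semigroup_imp_band:
  assumes "semigroup_on H m" "iso_to_partition_semigroup H m X P"
  shows "\<exists>C \<Omega>. band_of_order_two_groups H m C \<Omega>"
proof -
  have P: "partition_on X P" "at_least_two P"
    "semigroup_iso H m (generated_semigroup (sym_product_partition (id ` P))) (O)"
    using assms(2) unfolding iso_to_partition_semigroup_def by auto
  have "semigroup_iso H m (pair_relations P) (O)"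
    using P(3) by (subst (asm) semigroup_iso_generated_iff)
      (use P in \<open>auto simp: partition_on_def disjoint_def\<close>)
  then obtain f where "bij_betw f H (pair_relations P)"
    "\<And>x y. x \<in> H \<Longrightarrow> y \<in> H \<Longrightarrow> f (m x y) = f x O f y"
    unfolding semigroup_iso_def by blast
  then interpret pair_relation_model H m P f
    using assms(1) P(2) by unfold_locales
  show ?thesis using band_of_order_two_groups_core by blast
qed

section \<open>Elementary structure of a band of order-two groups with core\<close>

locale band_with_core =
  fixes H :: "'a set" and m :: "'a \<Rightarrow> 'a \<Rightarrow> 'a" (infixl \<open>\<cdot>\<close> 70)
    and C :: "'a set" and \<Omega> :: "'a set set"
  assumes semigroup: "semigroup_on H m"
    and band: "band_of_order_two_groups H m C \<Omega>"
begin

abbreviation E :: "'a set" where "E \<equiv> idempotents H m"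
abbreviation N :: "'a set" where "N \<equiv> nontrivial_idempotents C m"

lemma closed [simp]: "x \<in> H \<Longrightarrow> y \<in> H \<Longrightarrow> x \<cdot> y \<in> H"
  using semigroup unfolding semigroup_on_def by blast

lemma assoc: "x \<in> H \<Longrightarrow> y \<in> H \<Longrightarrow> z \<in> H \<Longrightarrow> x \<cdot> y \<cdot> z = x \<cdot> (y \<cdot> z)"
  using semigroup unfolding semigroup_on_def by blast

lemma band_of_semigroups: "band_of_semigroups H m C \<Omega>"
  and class_H1: "class_H1 C m"
  and groups: "A \<in> \<Omega> \<Longrightarrow> group_of_order_two A m"
  and commutative_band: "commutative_band m E"
  using band unfolding band_of_order_two_groups_def Let_def by simp_all

lemma covering_idempotent:
  "e1 \<in> N \<Longrightarrow> e2 \<in> N \<Longrightarrow> e1 \<noteq> e2 \<Longrightarrow> \<exists>!e. e \<in> E - C \<and> e1 = e1 \<cdot> e \<and> e2 = e2 \<cdot> e"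
  using band unfolding band_of_order_two_groups_def Let_def by simp

lemma covered_idempotents:
  "e \<in> E - C \<Longrightarrow> \<exists>e1\<in>N. \<exists>e2\<in>N. e1 \<noteq> e2 \<and> e1 = e1 \<cdot> e \<and> e2 = e2 \<cdot> e \<and>
     (\<forall>f\<in>N. f = f \<cdot> e \<longrightarrow> f = e1 \<or> f = e2)"
  using band unfolding band_of_order_two_groups_def Let_def by simp

lemma zero_iff_idempotent: "x \<in> E \<inter> C \<Longrightarrow> y \<in> H - E \<Longrightarrow> is_zero H m (x \<cdot> y) \<longleftrightarrow> x \<cdot> y \<in> E"
  using band unfolding band_of_order_two_groups_def Let_def by simp

lemma core_subset: "C \<subseteq> H"
  using band_of_semigroups unfolding band_of_semigroups_def semigroup_ideal_def subsemigroup_def by simp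

lemma core_mem [simp]: "c \<in> C \<Longrightarrow> c \<in> H"
  using core_subset by blast

lemma ideal [simp]: "c \<in> C \<Longrightarrow> h \<in> H \<Longrightarrow> c \<cdot> h \<in> C" "c \<in> C \<Longrightarrow> h \<in> H \<Longrightarrow> h \<cdot> c \<in> C"
  using band_of_semigroups unfolding band_of_semigroups_def semigroup_ideal_def by simp_all

lemma partition: "partition_on (H - C) \<Omega>"
  using band_of_semigroups unfolding band_of_semigroups_def by simp

text \<open>By cancellation the non-identity element \<open>s\<close> does not satisfy
  \<open>s \<cdot> s = s\<close>, so its square is \<open>e\<close> and it is no idempotent of
  \<open>H\<close>.\<close>

lemma block_structure:
  assumes "A \<in> \<Omega>"
  obtains e s where "A = {e, s}" "e \<in> E - C" "s \<in> H - C" "s \<notin> E"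
    "s \<cdot> s = e" "e \<cdot> s = s" "s \<cdot> e = s"
proof -
  obtain e where "group \<lparr>carrier = A, mult = m, one = e\<rparr>"
    and ord: "order \<lparr>carrier = A, mult = m, one = e\<rparr> = 2"
    using groups[OF assms] unfolding group_of_order_two_def by blast
  then interpret G: group "\<lparr>carrier = A, mult = m, one = e\<rparr>" by simp
  have A: "A \<subseteq> H - C" using assms partition unfolding partition_on_def by blast
  have e: "e \<in> A" "e \<cdot> e = e" using G.one_closed G.l_one[of e] by simp_all
  have "card A = 2" using ord unfolding order_def by simp
  then obtain s where s: "A = {e, s}" "s \<noteq> e"
    using e(1) by (metis card_2_iff doubleton_eq_iff insertE singletonD)
  have "s \<cdot> s \<in> A" using G.m_closed[of s s] s by simp
  moreover have "s \<cdot> s \<noteq> s" using G.l_cancel_one[of s s] s by simp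
  ultimately have ss: "s \<cdot> s = e" using s by simp
  have es: "e \<cdot> s = s" "s \<cdot> e = s" using G.l_one[of s] G.r_one[of s] s by simp_all
  show thesis
    by (rule that[of e s]) (use A e s ss es in \<open>auto simp: idempotents_def\<close>)
qed

lemma mem_block:
  assumes "x \<in> H - C"
  obtains A where "A \<in> \<Omega>" "x \<in> A"
  using assms partition unfolding partition_on_def by blast

text \<open>There is a block outside the core, and its idempotent covers two distinct members of
  \<open>N\<close>. It follows that the core is not a one-element semigroup and has a zero.\<close>

lemma two_N: "at_least_two N"
proof -
  have "H - C \<noteq> {}"
    using band_of_semigroups unfolding band_of_semigroups_def by simp
  then obtain x where "x \<in> H - C" by blast
  then obtain A where "A \<in> \<Omega>" by (rule mem_block)
  then obtain e where "e \<in> E - C" by (rule block_structure)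
  then show ?thesis
    using covered_idempotents[of e] unfolding at_least_two_def by blast
qed

lemma N_mem: "i \<in> N \<Longrightarrow> i \<in> C" "i \<in> N \<Longrightarrow> i \<cdot> i = i"
  unfolding nontrivial_idempotents_def idempotents_def by simp_all

lemma N_mem_H [simp]: "i \<in> N \<Longrightarrow> i \<in> H"
  using N_mem(1) by simp

lemma two_C: "at_least_two C"
  using two_N N_mem(1) unfolding at_least_two_def by blast

definition \<theta> :: 'a where "\<theta> = (SOME z. is_zero C m z)"

lemma zero_core: "is_zero C m \<theta>"
  using class_H1 two_C unfolding class_H1_def \<theta>_def by (simp add: someI_ex)

lemma theta_core: "\<theta> \<in> C"
  using zero_core unfolding is_zero_def by simp

lemma theta_mem_H [simp]: "\<theta> \<in> H"
  using theta_core by simp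

text \<open>Since \<open>\<theta> \<cdot> h\<close> lies in the core,
  \<open>\<theta> \<cdot> h = \<theta> \<cdot> (\<theta> \<cdot> h)\<close> equals
  \<open>\<theta>\<close>; symmetrically on the other side.\<close>

lemma theta_mult [simp]:
  assumes "h \<in> H"
  shows "\<theta> \<cdot> h = \<theta>" "h \<cdot> \<theta> = \<theta>"
proof -
  have *: "\<theta> \<cdot> c = \<theta>" "c \<cdot> \<theta> = \<theta>" if "c \<in> C" for c
    using zero_core that unfolding is_zero_def by simp_all
  have "\<theta> \<cdot> h = \<theta> \<cdot> \<theta> \<cdot> h" by (simp add: * theta_core)
  also have "\<dots> = \<theta> \<cdot> (\<theta> \<cdot> h)" using assms by (simp add: assoc)
  also have "\<dots> = \<theta>" using assms theta_core by (intro *) simp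
  finally show "\<theta> \<cdot> h = \<theta>" .
  have "h \<cdot> \<theta> = h \<cdot> (\<theta> \<cdot> \<theta>)" by (simp add: * theta_core)
  also have "\<dots> = h \<cdot> \<theta> \<cdot> \<theta>" using assms by (simp add: assoc)
  also have "\<dots> = \<theta>" using assms theta_core by (intro *) simp
  finally show "h \<cdot> \<theta> = \<theta>" .
qed

lemma zero_core_iff: "is_zero C m x \<longleftrightarrow> x = \<theta>"
  using zero_core unfolding is_zero_def by metis

lemma zero_iff: "is_zero H m x \<longleftrightarrow> x = \<theta>"
proof -
  have "at_least_two H" using two_C core_subset unfolding at_least_two_def by blast
  then have "is_zero H m \<theta>" unfolding is_zero_def by simp
  then show ?thesis unfolding is_zero_def by metis
qed

lemma N_nonzero: "i \<in> N \<Longrightarrow> i \<noteq> \<theta>"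
  unfolding nontrivial_idempotents_def zero_core_iff by simp

lemma core_idempotents_orthogonal:
  "x \<in> C \<Longrightarrow> y \<in> C \<Longrightarrow> x \<cdot> x = x \<Longrightarrow> y \<cdot> y = y \<Longrightarrow> x \<noteq> y \<Longrightarrow> x \<cdot> y = \<theta>"
proof -
  have "\<forall>x\<in>idempotents C m. \<forall>y\<in>idempotents C m. x \<noteq> y \<longrightarrow> is_zero C m (x \<cdot> y)"
    using class_H1 unfolding class_H1_def by (elim conjE)
  then show "x \<in> C \<Longrightarrow> y \<in> C \<Longrightarrow> x \<cdot> x = x \<Longrightarrow> y \<cdot> y = y \<Longrightarrow> x \<noteq> y \<Longrightarrow> x \<cdot> y = \<theta>"
    unfolding zero_core_iff idempotents_def by blast
qed

lemma N_orthogonal: "i \<in> N \<Longrightarrow> j \<in> N \<Longrightarrow> i \<noteq> j \<Longrightarrow> i \<cdot> j = \<theta>"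
  using core_idempotents_orthogonal N_mem by metis

lemma unit_unique:
  assumes "i \<in> N" "j \<in> N"
  shows "\<exists>!a. a \<in> C \<and> a \<noteq> \<theta> \<and> a = i \<cdot> a \<cdot> j"
proof -
  have "\<forall>i\<in>N. \<forall>j\<in>N. \<exists>!a. a \<in> C \<and> \<not> is_zero C m a \<and> a = i \<cdot> a \<cdot> j"
    using class_H1 unfolding class_H1_def by (elim conjE)
  from bspec[OF bspec[OF this assms(1)] assms(2)] show ?thesis
    unfolding zero_core_iff .
qed

text \<open>The pair comes from the last clause of \<open>class_H1\<close>; idempotency of its
  members makes each of them a one-sided identity for \<open>a\<close>.\<close>

lemma unit_supports:
  assumes "a \<in> C" "a \<noteq> \<theta>"
  obtains i j where "i \<in> N" "j \<in> N" "i \<cdot> a \<cdot> j = a" "i \<cdot> a = a" "a \<cdot> j = a"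
proof -
  have "at_least_two C \<longrightarrow> (\<forall>a\<in>C. \<not> is_zero C m a \<longrightarrow>
      (\<exists>!p. p \<in> N \<times> N \<and> a = fst p \<cdot> a \<cdot> snd p))"
    using class_H1 unfolding class_H1_def by (elim conjE)
  then have "\<exists>p. p \<in> N \<times> N \<and> a = fst p \<cdot> a \<cdot> snd p"
    using two_C assms unfolding zero_core_iff by blast
  then obtain i j where ij: "i \<in> N" "j \<in> N" "a = i \<cdot> a \<cdot> j"
    by (metis SigmaE fst_conv snd_conv)
  have "i \<cdot> a = i \<cdot> (i \<cdot> (a \<cdot> j))" using ij assms by (simp add: assoc)
  also have "\<dots> = i \<cdot> i \<cdot> (a \<cdot> j)" using ij assms by (simp add: assoc)
  also have "\<dots> = a" using ij assms by (simp add: assoc N_mem)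
  finally have "i \<cdot> a = a" .
  moreover have "a \<cdot> j = i \<cdot> a \<cdot> (j \<cdot> j)"
    using ij assms by (metis assoc core_mem ideal(2) N_mem_H)
  then have "a \<cdot> j = a" using ij by (simp add: N_mem)
  ultimately show thesis using that ij by metis
qed

lemma right_support_unique:
  assumes "c \<in> C" "k \<in> N" "j \<in> N" "c \<cdot> k = c" "c \<cdot> j \<noteq> \<theta>"
  shows "j = k"
proof (rule ccontr)
  assume "j \<noteq> k"
  then have "k \<cdot> j = \<theta>" using assms by (simp add: N_orthogonal)
  moreover have "c \<cdot> k \<cdot> j = c \<cdot> (k \<cdot> j)" using assms(1-3) by (simp add: assoc)
  ultimately show False using assms by simp
qed

text \<open>The right support of \<open>c\<close> is the only member of \<open>N\<close> that does
  not annihilate \<open>c\<close> from the right, so \<open>j\<close> must be that support.\<close>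

lemma right_support_absorbs:
  assumes "c \<in> C" "j \<in> N" "c \<cdot> j \<noteq> \<theta>"
  shows "c \<cdot> j = c"
proof -
  have "c \<noteq> \<theta>" using assms by auto
  then obtain k where "k \<in> N" "c \<cdot> k = c" using assms(1) unit_supports by metis
  then show ?thesis using assms right_support_unique by metis
qed

text \<open>The product \<open>k \<cdot> e\<close> is a core idempotent because \<open>E\<close> is
  a band. If it differs from \<open>k\<close>, it is orthogonal to \<open>k\<close>; but
  \<open>k \<cdot> (k \<cdot> e) = k \<cdot> e\<close>.\<close>

lemma mult_idempotent:
  assumes e: "e \<in> E" and k: "k \<in> N"
  shows "e \<cdot> k = k \<cdot> e" "k \<cdot> e = k \<or> k \<cdot> e = \<theta>"
proof -
  have kE: "k \<in> E" using k N_mem unfolding idempotents_def by simp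
  have eH: "e \<in> H" using e unfolding idempotents_def by simp
  show "e \<cdot> k = k \<cdot> e"
    using commutative_band e kE unfolding commutative_band_def by blast
  have "k \<cdot> e \<in> E"
    using commutative_band e kE unfolding commutative_band_def by blast
  then have "k \<cdot> e \<cdot> (k \<cdot> e) = k \<cdot> e" unfolding idempotents_def by simp
  then have "k \<cdot> e \<noteq> k \<Longrightarrow> k \<cdot> (k \<cdot> e) = \<theta>"
    using k eH N_mem by (intro core_idempotents_orthogonal) simp_all
  moreover have "k \<cdot> (k \<cdot> e) = k \<cdot> e"
    using k eH N_mem by (simp flip: assoc)
  ultimately show "k \<cdot> e = k \<or> k \<cdot> e = \<theta>" by metis
qed

section \<open>The representation by relations on \<open>N\<close> and its multiplicativity\<close>

definition rel :: "'a \<Rightarrow> ('a \<times> 'a) set" where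
  "rel h = {(i, j). i \<in> N \<and> j \<in> N \<and> i \<cdot> h \<cdot> j \<noteq> \<theta>}"

text \<open>Each \<open>i \<cdot> e\<close> is \<open>i\<close> or \<open>\<theta>\<close>, so
  \<open>i \<cdot> e \<cdot> j\<close> is \<open>i \<cdot> j\<close> or \<open>\<theta>\<close>, and
  orthogonality leaves only diagonal pairs.\<close>

lemma rel_idempotent:
  assumes "e \<in> E"
  shows "rel e = {(k, k) | k. k \<in> N \<and> k \<cdot> e = k}"
proof -
  have "i \<cdot> e \<cdot> j \<noteq> \<theta> \<longleftrightarrow> i = j \<and> i \<cdot> e = i" if "i \<in> N" "j \<in> N" for i j
    using mult_idempotent(2)[OF assms that(1)] that N_mem N_nonzero N_orthogonal by (metis theta_mult(1) N_mem_H)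
  then show ?thesis unfolding rel_def by blast
qed

text \<open>
  Condition (ii\<open>\<^sub>5\<close>) enters only here: \<open>i \<cdot> s\<close> is nonzero, hence not idempotent, hence different
  from \<open>i\<close>.
\<close>

lemma involution_swaps:
  assumes e: "e \<in> E" and s: "s \<in> H" "s \<notin> E" "s \<cdot> s = e" "s \<cdot> e = s"
    and i: "i \<in> N" "i \<cdot> e = i"
  obtains k where "k \<in> N" "k \<noteq> i" "k \<cdot> e = k" "i \<cdot> s \<cdot> k = i \<cdot> s" "i \<cdot> s \<noteq> \<theta>"
proof -
  have eH: "e \<in> H" using e unfolding idempotents_def by simp
  have "i \<cdot> s \<cdot> s = i" using i s by (simp add: assoc)
  then have nz: "i \<cdot> s \<noteq> \<theta>" using N_nonzero[OF i(1)] s(1) by auto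
  have isC: "i \<cdot> s \<in> C" using i s N_mem by simp
  then obtain k where k: "k \<in> N" "i \<cdot> s \<cdot> k = i \<cdot> s" using nz unit_supports by metis
  \<comment> \<open>Because \<open>s\<close> absorbs \<open>e\<close>, the product
    \<open>e \<cdot> k\<close> cannot vanish, and an idempotent either fixes or annihilates
    \<open>k\<close>.\<close>
  have "i \<cdot> s \<cdot> (e \<cdot> k) = i \<cdot> (s \<cdot> e) \<cdot> k" using i(1) s(1) k(1) eH by (simp add: assoc)
  then have "i \<cdot> s \<cdot> (e \<cdot> k) = i \<cdot> s" using s(4) k(2) by simp
  then have "e \<cdot> k \<noteq> \<theta>" using nz i(1) s(1) by auto
  then have ke: "k \<cdot> e = k" using mult_idempotent[OF e k(1)] by metis
  \<comment> \<open>With \<open>k = i\<close>, the element \<open>i \<cdot> s\<close> would be a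
    nonzero element of \<open>i \<cdot> C \<cdot> i\<close>, and \<open>i\<close> is the only
    one.\<close>
  have "k \<noteq> i"
  proof
    assume "k = i"
    then have "i \<cdot> s = i \<cdot> (i \<cdot> s) \<cdot> i"
      using i s k N_mem by (simp flip: assoc)
    moreover have "i \<cdot> i \<cdot> i = i" using i N_mem by simp
    ultimately have "i \<cdot> s = i"
      using unit_unique[OF i(1) i(1)] isC nz N_mem N_nonzero i by metis
    moreover have "i \<in> E \<inter> C" using i N_mem unfolding idempotents_def by simp
    ultimately show False
      using zero_iff_idempotent[of i s] s nz by (simp add: zero_iff)
  qed
  with k ke nz that show thesis by metis
qed

text \<open>From \<open>e \<cdot> s = s\<close>, row \<open>k\<close> of the relation is empty
  unless \<open>e\<close> fixes \<open>k\<close>, which leaves rows \<open>i\<close> and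
  \<open>j\<close>. In each of them the right support is fixed by \<open>e\<close> and differs from
  the row index, so it is the other index.\<close>

lemma rel_involution:
  assumes e: "e \<in> E" and s: "s \<in> H" "s \<notin> E" "s \<cdot> s = e" "e \<cdot> s = s" "s \<cdot> e = s"
    and ij: "i \<in> N" "j \<in> N" "i \<noteq> j" "i \<cdot> e = i" "j \<cdot> e = j"
    and only: "\<And>k. k \<in> N \<Longrightarrow> k \<cdot> e = k \<Longrightarrow> k = i \<or> k = j"
  shows "rel s = {(i, j), (j, i)}"
proof -
  have eH: "e \<in> H" using e unfolding idempotents_def by simp
  have *: "p \<cdot> s \<cdot> l \<noteq> \<theta> \<longleftrightarrow> l = q"
    if p: "p \<in> N" "q \<in> N" "p \<cdot> e = p" and pq: "\<And>k. k \<in> N \<Longrightarrow> k \<cdot> e = k \<Longrightarrow> k = p \<or> k = q" and l: "l \<in> N" for p q l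
  proof -
    obtain k where k: "k \<in> N" "k \<noteq> p" "k \<cdot> e = k" "p \<cdot> s \<cdot> k = p \<cdot> s" "p \<cdot> s \<noteq> \<theta>"
      using involution_swaps[OF e s(1-3) s(5) p(1,3)] by metis
    then have "k = q" using pq by blast
    moreover have "p \<cdot> s \<in> C" using p(1) s(1) N_mem by simp
    ultimately show ?thesis using k l right_support_unique by metis
  qed
  have "k = i \<or> k = j" if "k \<in> N" "l \<in> N" "k \<cdot> s \<cdot> l \<noteq> \<theta>" for k l
  proof -
    have "k \<cdot> s = k \<cdot> e \<cdot> s" using that eH s by (simp add: assoc)
    then have "k \<cdot> e \<noteq> \<theta>" using that s by auto
    then show ?thesis using mult_idempotent(2)[OF e that(1)] only that(1) by blast
  qed
  moreover have "i \<cdot> s \<cdot> l \<noteq> \<theta> \<longleftrightarrow> l = j" "j \<cdot> s \<cdot> l \<noteq> \<theta> \<longleftrightarrow> l = i" if "l \<in> N" for l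
    using *[of i j l] *[of j i l] ij only that by blast+
  ultimately show ?thesis
    unfolding rel_def using ij by auto
qed

lemma outer_block:
  assumes "A \<in> \<Omega>"
  obtains e s i j where "A = {e, s}" "e \<in> E - C" "s \<in> H - C" "s \<notin> E"
    "i \<in> N" "j \<in> N" "i \<noteq> j" "i \<cdot> e = i" "j \<cdot> e = j" "s \<cdot> s = e"
    "rel e = {(i, i), (j, j)}" "rel s = {(i, j), (j, i)}"
proof -
  obtain e s where es: "A = {e, s}" "e \<in> E - C" "s \<in> H - C" "s \<notin> E"
    "s \<cdot> s = e" "e \<cdot> s = s" "s \<cdot> e = s"
    using assms by (rule block_structure)
  obtain i j where ij: "i \<in> N" "j \<in> N" "i \<noteq> j" "i \<cdot> e = i" "j \<cdot> e = j"
    and only: "\<And>k. k \<in> N \<Longrightarrow> k \<cdot> e = k \<Longrightarrow> k = i \<or> k = j"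
    using covered_idempotents[OF es(2)] by metis
  have "rel s = {(i, j), (j, i)}"
    by (rule rel_involution[of e]) (use es ij only in simp_all)
  moreover have "rel e = {(i, i), (j, j)}"
    using rel_idempotent[of e] es ij only by auto
  ultimately show thesis using that es ij by metis
qed

text \<open>Take the block of the idempotent covering \<open>i\<close> and \<open>j\<close>. Its two
  indices must be \<open>i\<close> and \<open>j\<close>, because \<open>(i, i)\<close> and
  \<open>(j, j)\<close> belong to \<open>rel e\<close>.\<close>

lemma outer_block_of_pair:
  assumes "i \<in> N" "j \<in> N" "i \<noteq> j"
  obtains e s where "e \<in> H" "s \<in> H" "i \<cdot> e = i" "j \<cdot> e = j" "s \<cdot> s = e"
    "rel e = {(i, i), (j, j)}" "rel s = {(i, j), (j, i)}"
proof -
  obtain e where e: "e \<in> E - C" "i \<cdot> e = i" "j \<cdot> e = j"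
    using covering_idempotent[OF assms] by metis
  then have "e \<in> H - C" unfolding idempotents_def by simp
  then obtain A where A: "A \<in> \<Omega>" "e \<in> A" by (rule mem_block)
  obtain e' s k l where A': "A = {e', s}" "e' \<in> E - C" "s \<in> H - C" "s \<notin> E"
    "k \<in> N" "l \<in> N" "k \<noteq> l" "k \<cdot> e' = k" "l \<cdot> e' = l" "s \<cdot> s = e'"
    "rel e' = {(k, k), (l, l)}" "rel s = {(k, l), (l, k)}"
    using A(1) by (rule outer_block)
  have e': "e' = e" using A A' e by blast
  have "(i, i) \<in> rel e" "(j, j) \<in> rel e"
    using rel_idempotent[of e] e assms by blast+
  then have "i = k \<and> j = l \<or> i = l \<and> j = k"
    using A' e' assms(3) by auto
  then have "rel e = {(i, i), (j, j)}" "rel s = {(i, j), (j, i)}"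
    using A' e' by auto
  with \<open>e \<in> H - C\<close> A' e' e that show thesis by blast
qed

lemma units_mult_nonzero:
  assumes c: "c \<in> C" "c \<noteq> \<theta>" "i \<in> N" "j \<in> N" "i \<cdot> c \<cdot> j = c"
    and d: "d \<in> C" "d \<noteq> \<theta>" "j \<cdot> d = d"
  shows "c \<cdot> d \<noteq> \<theta>"
proof (cases "i = j")
  case True
  have "j \<cdot> j \<cdot> j = j" using c N_mem by simp
  \<comment> \<open>Both are nonzero elements of \<open>j \<cdot> C \<cdot> j\<close>, which has
    only one.\<close>
  then have "c = j" using True unit_unique[OF c(4) c(4)] c N_mem N_nonzero by metis
  then show ?thesis using d by simp
next
  case False
  obtain e s where es: "e \<in> H" "s \<in> H" "i \<cdot> e = i" "j \<cdot> e = j" "s \<cdot> s = e"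
    "rel s = {(i, j), (j, i)}"
    using outer_block_of_pair[OF c(3,4) False] by metis
  have "(i, j) \<in> rel s" "(j, i) \<in> rel s" using es by simp_all
  then have nz: "i \<cdot> s \<cdot> j \<noteq> \<theta>" "j \<cdot> s \<cdot> i \<noteq> \<theta>" unfolding rel_def by simp_all
  have i_s: "i \<cdot> s \<cdot> j = i \<cdot> s" and j_s: "j \<cdot> s \<cdot> i = j \<cdot> s"
    using right_support_absorbs[of "i \<cdot> s" j] right_support_absorbs[of "j \<cdot> s" i] nz c es N_mem by simp_all
  \<comment> \<open>This places \<open>i \<cdot> s\<close> in \<open>i \<cdot> C \<cdot> j\<close>,
    where the nonzero element is unique and hence equal to \<open>c\<close>.\<close>
  have "i \<cdot> (i \<cdot> s) \<cdot> j = i \<cdot> s"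
    using i_s c es N_mem by (simp flip: assoc)
  moreover have "i \<cdot> s \<in> C" "i \<cdot> s \<noteq> \<theta>" using i_s nz c es N_mem by simp_all
  ultimately have c': "c = i \<cdot> s" using unit_unique[OF c(3,4)] c by metis
  have "j \<cdot> s \<cdot> c = j \<cdot> s \<cdot> i \<cdot> s" using c' c es by (simp add: assoc)
  also have "\<dots> = j \<cdot> (s \<cdot> s)" using j_s c es by (simp add: assoc)
  finally have "j \<cdot> s \<cdot> c = j" using es by simp
  \<comment> \<open>Left multiplication by \<open>j \<cdot> s\<close> undoes \<open>c\<close> and
    recovers \<open>d\<close>, so \<open>c \<cdot> d\<close> cannot be zero.\<close>
  then have "j \<cdot> s \<cdot> (c \<cdot> d) = d"
    using c d es by (simp flip: assoc)
  then show ?thesis using d c es by auto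
qed

text \<open>For the first inclusion the middle index is the right support of
  \<open>i \<cdot> h\<close>. For the second, \<open>j\<close> supports \<open>i \<cdot> h\<close>
  on the right and \<open>j \<cdot> g \<cdot> l\<close> on the left, so their product is nonzero by
  \<open>units_mult_nonzero\<close>.\<close>

lemma rel_mult:
  assumes h: "h \<in> H" and g: "g \<in> H"
  shows "rel (h \<cdot> g) = rel h O rel g"
proof (intro subset_antisym subrelI)
  fix i l assume "(i, l) \<in> rel (h \<cdot> g)"
  then have i: "i \<in> N" and l: "l \<in> N" and "i \<cdot> (h \<cdot> g) \<cdot> l \<noteq> \<theta>" unfolding rel_def by simp_all
  then have nz: "i \<cdot> h \<cdot> (g \<cdot> l) \<noteq> \<theta>" using h g by (simp add: assoc)
  then have "i \<cdot> h \<noteq> \<theta>" using l g by auto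
  moreover have "i \<cdot> h \<in> C" using i h N_mem by simp
  ultimately obtain k where k: "k \<in> N" "i \<cdot> h \<cdot> k = i \<cdot> h" using unit_supports by metis
  have "i \<cdot> h \<cdot> (k \<cdot> g \<cdot> l) = i \<cdot> h \<cdot> k \<cdot> (g \<cdot> l)" using i l k(1) h g by (simp add: assoc)
  then have "k \<cdot> g \<cdot> l \<noteq> \<theta>" using nz k i h by auto
  then show "(i, l) \<in> rel h O rel g"
    using i l k \<open>i \<cdot> h \<noteq> \<theta>\<close> unfolding rel_def by auto
next
  fix i l assume "(i, l) \<in> rel h O rel g"
  then obtain j where i: "i \<in> N" and j: "j \<in> N" and l: "l \<in> N"
    and nz: "i \<cdot> h \<cdot> j \<noteq> \<theta>" "j \<cdot> g \<cdot> l \<noteq> \<theta>"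
    unfolding rel_def by blast
  have ihj: "i \<cdot> h \<cdot> j = i \<cdot> h"
    using right_support_absorbs[of "i \<cdot> h" j] nz i j h N_mem by simp
  have "i \<cdot> h \<cdot> (j \<cdot> g \<cdot> l) \<noteq> \<theta>"
  proof (rule units_mult_nonzero[of _ i j])
    show "i \<cdot> h \<in> C" "i \<in> N" "j \<in> N" "j \<cdot> g \<cdot> l \<in> C" "j \<cdot> g \<cdot> l \<noteq> \<theta>"
      using i j l h g N_mem nz by simp_all
    show "i \<cdot> h \<noteq> \<theta>" using nz ihj by simp
    show "i \<cdot> (i \<cdot> h) \<cdot> j = i \<cdot> h" using ihj i j h N_mem by (simp flip: assoc)
    show "j \<cdot> (j \<cdot> g \<cdot> l) = j \<cdot> g \<cdot> l" using j l g N_mem by (simp flip: assoc)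
  qed
  moreover have "i \<cdot> h \<cdot> (j \<cdot> g \<cdot> l) = i \<cdot> h \<cdot> j \<cdot> (g \<cdot> l)" using i j l h g by (simp add: assoc)
  ultimately have "i \<cdot> (h \<cdot> g) \<cdot> l \<noteq> \<theta>" using ihj i l h g by (simp add: assoc)
  then show "(i, l) \<in> rel (h \<cdot> g)" using i l unfolding rel_def by simp
qed

section \<open>Shapes of the elements and bijectivity of the representation\<close>

lemma rel_zero: "rel \<theta> = {}"
  unfolding rel_def by auto

text \<open>Writing \<open>k \<cdot> a \<cdot> l\<close> as
  \<open>k \<cdot> i \<cdot> (a \<cdot> (j \<cdot> l))\<close>, orthogonality annihilates it unless
  \<open>k = i\<close> and \<open>l = j\<close>.\<close>

lemma rel_unit:
  assumes "a \<in> C" "a \<noteq> \<theta>" "i \<in> N" "j \<in> N" "i \<cdot> a \<cdot> j = a"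
  shows "rel a = {(i, j)}"
proof -
  have *: "k = i \<and> l = j" if kl: "k \<in> N" "l \<in> N" "k \<cdot> a \<cdot> l \<noteq> \<theta>" for k l
  proof -
    have "k \<cdot> a \<cdot> l = k \<cdot> (i \<cdot> a \<cdot> j) \<cdot> l" using assms(5) by simp
    also have "\<dots> = k \<cdot> i \<cdot> (a \<cdot> (j \<cdot> l))" using assms(1-4) kl(1,2) by (simp add: assoc)
    finally have "k \<cdot> i \<cdot> (a \<cdot> (j \<cdot> l)) \<noteq> \<theta>" using kl(3) by simp
    then have "k \<cdot> i \<noteq> \<theta>" "j \<cdot> l \<noteq> \<theta>" using kl(1,2) assms(1-4) by auto
    then show ?thesis using kl(1,2) assms(3,4) N_orthogonal by metis
  qed
  have "(i, j) \<in> rel a" using assms unfolding rel_def by simp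
  moreover have "rel a \<subseteq> {(i, j)}" unfolding rel_def using * by blast
  ultimately show ?thesis by blast
qed

text \<open>The cases mirror \<open>pair_relations_cases\<close>. The \<open>swap\<close> case
  records the idempotent \<open>e\<close> of the block, since an involution is later identified
  through its block.\<close>

lemma element_cases [consumes 1, case_names zero unit diag swap]:
  assumes "x \<in> H"
  obtains "x = \<theta>"
  | i j where "x \<in> C" "x \<noteq> \<theta>" "i \<in> N" "j \<in> N" "i \<cdot> x \<cdot> j = x" "rel x = {(i, j)}"
  | i j where "x \<in> E - C" "i \<in> N" "j \<in> N" "i \<noteq> j" "i \<cdot> x = i" "j \<cdot> x = j"
      "rel x = {(i, i), (j, j)}"
  | e i j where "{e, x} \<in> \<Omega>" "e \<in> E - C" "x \<notin> E" "i \<in> N" "j \<in> N" "i \<noteq> j" "i \<cdot> e = i" "j \<cdot> e = j"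
      "rel x = {(i, j), (j, i)}"
proof (cases "x \<in> C")
  case True
  show ?thesis
  proof (cases "x = \<theta>")
    case True
    then show ?thesis by (rule that(1))
  next
    case False
    then show ?thesis using \<open>x \<in> C\<close> unit_supports[of x] rel_unit[of x] that(2) by metis
  qed
next
  case False
  then obtain A where A: "A \<in> \<Omega>" "x \<in> A" using assms mem_block by blast
  obtain e s i j where es: "A = {e, s}" "e \<in> E - C" "s \<in> H - C" "s \<notin> E"
    "i \<in> N" "j \<in> N" "i \<noteq> j" "i \<cdot> e = i" "j \<cdot> e = j" "s \<cdot> s = e"
    "rel e = {(i, i), (j, j)}" "rel s = {(i, j), (j, i)}"
    using A(1) by (rule outer_block)
  show ?thesis
  proof (cases "x = e")
    case True
    then show ?thesis using that(3) es by blast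
  next
    case False
    then have "x = s" using A es by simp
    then show ?thesis using that(4) es A by blast
  qed
qed

text \<open>The indices are compared as sets because a relation determines them only up to
  order.\<close>

lemma covering_idempotent_unique:
  assumes "e \<in> E - C" "e' \<in> E - C" "i \<in> N" "j \<in> N" "i \<noteq> j" "{i, j} = {k, l}"
    "i \<cdot> e = i" "j \<cdot> e = j" "k \<cdot> e' = k" "l \<cdot> e' = l"
  shows "e = e'"
proof -
  have "i \<cdot> e' = i" "j \<cdot> e' = j" using assms(6,9,10) by (metis insertE insertI1 insert_commute singletonD)+
  then show ?thesis using covering_idempotent[OF assms(3-5)] assms(1,2,7,8) by metis
qed

text \<open>The relation reveals the shape of an element and its indices. A unit is then unique by
  \<open>unit_unique\<close>, an outer idempotent by the pair it covers, and an involution by the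
  idempotent of its group.\<close>

lemma inj_on_rel: "inj_on rel H"
proof (rule inj_onI)
  fix x y assume x: "x \<in> H" and y: "y \<in> H" and eq: "rel x = rel y"
  from x show "x = y"
  proof (cases rule: element_cases)
    case zero
    with eq have "rel y = {}" by (simp add: rel_zero)
    with y show ?thesis using zero by (cases rule: element_cases) auto
  next
    case x: (unit i j)
    from y show ?thesis
    proof (cases rule: element_cases)
      case (unit k l)
      then have "k = i" "l = j" using x eq by simp_all
      then show ?thesis using x unit unit_unique[of i j] by metis
    qed (use x eq rel_zero in auto)
  next
    case x: (diag i j)
    from y show ?thesis
    proof (cases rule: element_cases)
      case (diag k l)
      then have "{i, j} = {k, l}" using x eq by (auto simp: doubleton_eq_iff)
      then show ?thesis using covering_idempotent_unique[of x y i j k l] x diag by simp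
    qed (use x eq rel_zero in auto)
  next
    case x: (swap e i j)
    from y show ?thesis
    proof (cases rule: element_cases)
      case (swap e' k l)
      then have "{i, j} = {k, l}" using x eq by (auto simp: doubleton_eq_iff)
      then have "e = e'" using covering_idempotent_unique[of e e' i j k l] x swap by simp
      \<comment> \<open>Two blocks that share \<open>e\<close> coincide, and each contains only one
        further element.\<close>
      then have "{e, x} \<inter> {e, y} \<noteq> {}" "{e, x} \<in> \<Omega>" "{e, y} \<in> \<Omega>"
        using x(1) swap(1) by simp_all
      then have "{e, x} = {e, y}"
        using disjointD[OF partition_onD2[OF partition]] by metis
      then show ?thesis by (auto simp: doubleton_eq_iff)
    qed (use x(6,9) eq rel_zero in \<open>auto simp: doubleton_eq_iff\<close>)
  qed
qed

lemma rel_image: "rel ` H = pair_relations N"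
proof (intro equalityI subsetI)
  fix R assume "R \<in> rel ` H"
  then obtain x where x: "x \<in> H" "R = rel x" by blast
  from x(1) show "R \<in> pair_relations N"
    by (cases rule: element_cases) (auto simp: x(2) rel_zero)
next
  fix R assume "R \<in> pair_relations N"
  then show "R \<in> rel ` H"
  proof (cases rule: pair_relations_cases)
    case empty
    then show ?thesis using rel_zero by (metis imageI theta_mem_H)
  next
    case (unit i j)
    then obtain a where "a \<in> C" "a \<noteq> \<theta>" "i \<cdot> a \<cdot> j = a" using unit_unique[of i j] by metis
    then show ?thesis using unit rel_unit by (metis imageI core_mem)
  next
    case (diag i j)
    then show ?thesis using outer_block_of_pair[of i j] by (metis imageI)
  next
    case (swap i j)
    then show ?thesis using outer_block_of_pair[of i j] by (metis imageI)
  qed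
qed

lemma semigroup_iso_pair_relations: "semigroup_iso H m (pair_relations N) (O)"
  unfolding semigroup_iso_def bij_betw_def
  using inj_on_rel rel_image rel_mult by blast

end

section \<open>The converse and the equivalence\<close>

lemma band_imp_iso_to_partition_semigroup:
  fixes H :: "'a set"
  assumes "semigroup_on H m" "band_of_order_two_groups H m C \<Omega>"
  shows "\<exists>(X :: 'a set) P. iso_to_partition_semigroup H m X P"
proof -
  interpret band_with_core H m C \<Omega>
    using assms by unfold_locales
  \<comment> \<open>The index set itself serves as \<open>X\<close>, cut into singletons.\<close>
  let ?P = "(\<lambda>i. {i}) ` N"
  have "N \<noteq> {}" "at_least_two ?P"
    using two_N unfolding at_least_two_def by auto
  moreover have "partition_on N ?P"
    by (auto simp: partition_on_def disjoint_def)
  moreover have "semigroup_iso H m (generated_semigroup (sym_product_partition ?P)) (O)"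
    by (subst semigroup_iso_generated_iff) (simp_all add: two_N semigroup_iso_pair_relations)
  ultimately show ?thesis unfolding iso_to_partition_semigroup_def by blast
qed

text \<open>The set \<open>X\<close> built in the converse consists of elements of \<open>H\<close>,
  so the equivalence can be stated with \<open>X\<close> in the type of \<open>H\<close>. The last
  conjunct extends the forward direction to \<open>X\<close> in an arbitrary type.\<close>

theorem theorem4p6:
  fixes H :: "'a set" and m :: "'a \<Rightarrow> 'a \<Rightarrow> 'a"
  assumes "semigroup_on H m"
  shows "((\<exists>(X :: 'a set) P. iso_to_partition_semigroup H m X P) \<longleftrightarrow>
            (\<exists>C \<Omega>. band_of_order_two_groups H m C \<Omega>)) \<and>
         ((\<exists>(X :: 'x set) P. iso_to_partition_semigroup H m X P) \<longrightarrow>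
            (\<exists>C \<Omega>. band_of_order_two_groups H m C \<Omega>))"
proof (intro conjI iffI impI)
  show "\<exists>C \<Omega>. band_of_order_two_groups H m C \<Omega>"
    if "\<exists>(X :: 'a set) P. iso_to_partition_semigroup H m X P"
    using that iso_to_partition_semigroup_imp_band[OF assms] by metis
  show "\<exists>(X :: 'a set) P. iso_to_partition_semigroup H m X P"
    if "\<exists>C \<Omega>. band_of_order_two_groups H m C \<Omega>"
    using that band_imp_iso_to_partition_semigroup[OF assms] by metis
  show "\<exists>C \<Omega>. band_of_order_two_groups H m C \<Omega>"
    if "\<exists>(X :: 'x set) P. iso_to_partition_semigroup H m X P"
    using that iso_to_partition_semigroup_imp_band[OF assms] by metis
qed

end
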